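(* Let $\lambda\in\mathbb{R}$. For every $n\in\mathbb{N}$ (i.e. $n\ge1$), \[ A_{n,\lambda}(t)=\sum_{k=0}^{n-1}\binom{n}{k}A_{k,\lambda}(t)\,(t-1)^{n-k-1}\,\langle 1\rangle_{n-k,\lambda}. \]
   Context: For $\lambda\in\mathbb{R}$, $(y)_{0,\lambda}=1$ and $(y)_{n,\lambda}=y(y-\lambda)\cdots(y-(n-1)\lambda)$ for $n\ge1$; also $\langle y\rangle_{0,\lambda}=1$ and $\langle y\rangle_{n,\lambda}=y(y+\lambda)\cdots(y+(n-1)\lambda)$ for $n\ge1$, so $\langle 1\rangle_{n,\lambda}=1(1+\lambda)\cdots(1+(n-1)\lambda)$. The degenerate Eulerian polynomials $A_{n,\lambda}(t)$ ($n\ge0$) are defined by $\frac{A_{n,\lambda}(t)}{(1-t)^{n+1}}=\sum_{j=0}^{\infty}(j+1)_{n,\lambda}t^{j}$ (as formal power series in $t$). *)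

theory Defs
  imports "HOL-Computational_Algebra.Computational_Algebra"
begin

definition deg_falling :: "real \<Rightarrow> real \<Rightarrow> nat \<Rightarrow> real" where
  "deg_falling l y n = (\<Prod>i<n. y - of_nat i * l)"

definition deg_rising :: "real \<Rightarrow> real \<Rightarrow> nat \<Rightarrow> real" where
  "deg_rising l y n = (\<Prod>i<n. y + of_nat i * l)"

definition deg_eulerian_poly :: "real \<Rightarrow> nat \<Rightarrow> real poly" where
  "deg_eulerian_poly l n =
     (THE p. fps_of_poly p / (1 - fps_X) ^ (n + 1) =
             Abs_fps (\<lambda>j. deg_falling l (of_nat j + 1) n))"

lemma deg_eulerian_unique:
  fixes p q :: "real poly"
  assumes "fps_of_poly p / (1 - fps_X) ^ m = fps_of_poly q / (1 - fps_X) ^ m"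
  shows "p = q"
proof -
  have nz: "((1 - fps_X :: real fps) ^ m) $ 0 \<noteq> 0"
    by (simp add: fps_power_zeroth)
  then have "fps_of_poly r / (1 - fps_X) ^ m * (1 - fps_X) ^ m = fps_of_poly r" for r :: "real poly"
    by (simp add: fps_divide_unit mult.assoc inverse_mult_eq_1)
  then have "fps_of_poly p = fps_of_poly q" using assms by metis
  then show ?thesis by simp
qed

lemma deg_eulerian_ex:
  "\<exists>p :: real poly. fps_of_poly p =
     Abs_fps (\<lambda>j. deg_falling l (of_nat j + 1) n) * (1 - fps_X) ^ (n + 1)"
proof (induction n)
  case 0
  have "Abs_fps (\<lambda>j. deg_falling l (of_nat j + 1) 0) * (1 - fps_X) ^ (0 + 1) = (1 :: real fps)"
    by (rule fps_ext) (simp add: deg_falling_def right_diff_distrib)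
  then show ?case by (intro exI[of _ 1]) simp
next
  case (Suc n)
  let ?F = "\<lambda>n. Abs_fps (\<lambda>j. deg_falling l (of_nat j + 1) n)"
  let ?c = "1 - of_nat n * l"
  let ?u = "1 - fps_X :: real fps"
  from Suc obtain p :: "real poly" where p: "fps_of_poly p = ?F n * ?u ^ (n + 1)" by blast
  have F: "?F (Suc n) = fps_const ?c * ?F n + fps_X * fps_deriv (?F n)"
    by (rule fps_ext) (auto simp: deg_falling_def algebra_simps)
  have d: "fps_deriv (fps_of_poly p) = fps_deriv (?F n) * ?u ^ (n + 1) - of_nat (n + 1) * ?F n * ?u ^ n"
    unfolding p by (simp add: fps_deriv_power algebra_simps del: of_nat_Suc power_Suc fps_const_neg
        flip: fps_of_nat fps_const_neg)
  have "?F (Suc n) * ?u ^ (Suc n + 1) =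
     fps_const ?c * (?u * fps_of_poly p) + fps_X * (?u * fps_deriv (fps_of_poly p)
        + of_nat (n + 1) * fps_of_poly p)"
    unfolding F d unfolding p by (simp add: algebra_simps del: of_nat_Suc)
  also have "\<dots> = fps_of_poly (smult ?c ([:1, -1:] * p) + [:0, 1:] * ([:1, -1:] * pderiv p
        + smult (of_nat (n + 1)) p))"
    by (simp add: fps_of_poly_simps fps_of_poly_pCons fps_of_poly_pderiv fps_of_poly_smult
        del: mult_pCons_left of_nat_Suc fps_const_neg flip: fps_of_nat fps_const_neg)
  finally show ?case by metis
qed

lemma deg_eulerian_poly_spec:
  "fps_of_poly (deg_eulerian_poly l n) / (1 - fps_X) ^ (n + 1) =
     Abs_fps (\<lambda>j. deg_falling l (of_nat j + 1) n)"
proof -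
  obtain p :: "real poly"
    where p: "fps_of_poly p = Abs_fps (\<lambda>j. deg_falling l (of_nat j + 1) n) * (1 - fps_X) ^ (n + 1)"
    using deg_eulerian_ex by blast
  have nz: "(1 - fps_X :: real fps) ^ (n + 1) \<noteq> 0"
    by (metis fps_X_neq_one power_not_zero right_minus_eq)
  have q: "fps_of_poly p / (1 - fps_X) ^ (n + 1) = Abs_fps (\<lambda>j. deg_falling l (of_nat j + 1) n)"
    unfolding p using nz by (rule nonzero_mult_div_cancel_right)
  show ?thesis
    unfolding deg_eulerian_poly_def
    by (rule theI[of _ p]) (use q deg_eulerian_unique in metis)+
qed

end

theory Submission
  imports Defs
begin

text \<open>Write \<open>F\<^sub>k\<close> for the power series with coefficients \<open>(j + 1)\<^bsub>k,\<lambda>\<^esub>\<close>, so that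
  \<open>A\<^sub>k = F\<^sub>k (1 - t)\<^bsup>k + 1\<^esup>\<close>. After cancelling \<open>(1 - t)\<^bsup>n\<^esup>\<close> the claim is the formula
  \<open>(1 - t) F\<^sub>n = - \<Sum>k<n. (n choose k) (-1)\<^bsub>n - k,\<lambda>\<^esub> F\<^sub>k\<close>, because
  \<open>(-1)\<^bsub>m,\<lambda>\<^esub> = (-1)\<^bsup>m\<^esup> \<langle>1\<rangle>\<^bsub>m,\<lambda>\<^esub>\<close>. Comparing coefficients of \<open>t\<^bsup>j\<^esup>\<close>, this is the Vandermonde
  identity for the degenerate falling factorials, applied to \<open>j = (j + 1) + (-1)\<close>.\<close>

lemma deg_falling_0 [simp]: "deg_falling l y 0 = 1"
  by (simp add: deg_falling_def)

lemma deg_falling_Suc: "deg_falling l y (Suc n) = deg_falling l y n * (y - of_nat n * l)"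
  by (simp add: deg_falling_def)

lemma deg_falling_zero_left: "n > 0 \<Longrightarrow> deg_falling l 0 n = 0"
  by (auto simp: deg_falling_def)

lemma deg_falling_uminus: "deg_falling l (- y) n = (- 1) ^ n * deg_rising l y n"
proof -
  have "deg_falling l (- y) n = (\<Prod>i<n. (- 1) * (y + of_nat i * l))"
    by (simp add: deg_falling_def)
  then show ?thesis
    by (simp only: prod.distrib deg_rising_def) simp
qed

text \<open>Induction on \<open>n\<close>: the new factor splits as
  \<open>x + y - n * l = (x - k * l) + (y - (n - k) * l)\<close>. The two parts extend the falling
  factorial in \<open>x\<close> and in \<open>y\<close> respectively, and Pascal's rule merges the
  two sums.\<close>

lemma deg_falling_Vandermonde:
  "deg_falling l (x + y) n =
     (\<Sum>k\<le>n. of_nat (n choose k) * deg_falling l x k * deg_falling l y (n - k))"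
proof (induction n)
  case 0
  show ?case by simp
next
  case (Suc n)
  let ?x = "deg_falling l x" and ?y = "deg_falling l y"
  define g where "g k = ?x k * ?y (Suc n - k)" for k
  have split_factor: "of_nat (n choose k) * ?x k * ?y (n - k) * (x + y - of_nat n * l)
      = of_nat (n choose k) * g (Suc k) + of_nat (n choose k) * g k" if "k \<le> n" for k
    using that by (simp add: g_def deg_falling_Suc Suc_diff_le of_nat_diff algebra_simps)
  \<comment> \<open>The added term vanishes since \<open>n choose Suc n = 0\<close>; after the index
    shift both sums run over \<open>g (Suc k)\<close>.\<close>
  have "(\<Sum>k\<le>n. of_nat (n choose k) * g k) = (\<Sum>k\<le>Suc n. of_nat (n choose k) * g k)"
    by simp
  also have "\<dots> = g 0 + (\<Sum>k\<le>n. of_nat (n choose Suc k) * g (Suc k))"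
    by (subst sum.atMost_Suc_shift) simp
  finally have shift: "(\<Sum>k\<le>n. of_nat (n choose k) * g k) =
      g 0 + (\<Sum>k\<le>n. of_nat (n choose Suc k) * g (Suc k))" .
  have "deg_falling l (x + y) (Suc n) =
      (\<Sum>k\<le>n. of_nat (n choose k) * g (Suc k) + of_nat (n choose k) * g k)"
    unfolding deg_falling_Suc Suc.IH sum_distrib_right
    by (intro sum.cong refl split_factor) simp
  also have "\<dots> = g 0 + (\<Sum>k\<le>n. of_nat (Suc n choose Suc k) * g (Suc k))"
    by (simp add: sum.distrib shift distrib_right)
  also have "\<dots> = (\<Sum>k\<le>Suc n. of_nat (Suc n choose k) * g k)"
    by (subst sum.atMost_Suc_shift) simp
  finally show ?case
    by (simp add: g_def mult.assoc)
qed

definition deg_falling_fps :: "real \<Rightarrow> nat \<Rightarrow> real fps" where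
  "deg_falling_fps l n = Abs_fps (\<lambda>j. deg_falling l (of_nat j + 1) n)"

text \<open>Powers of \<open>1 - fps_X\<close> have nonzero constant term, hence are units, so the
  defining quotient can be multiplied out.\<close>

lemma fps_of_poly_deg_eulerian:
  "fps_of_poly (deg_eulerian_poly l n) = deg_falling_fps l n * (1 - fps_X) ^ (n + 1)"
proof -
  have "(1 - fps_X :: real fps) ^ m $ 0 \<noteq> 0" for m
    by (simp add: fps_power_zeroth)
  then have "f / (1 - fps_X) ^ m * (1 - fps_X) ^ m = f" for f :: "real fps" and m
    by (simp add: fps_divide_unit mult.assoc inverse_mult_eq_1)
  then show ?thesis
    by (metis deg_eulerian_poly_spec deg_falling_fps_def)
qed

lemma deg_falling_fps_recurrence:
  assumes "n > 0"
  shows "(1 - fps_X) * deg_falling_fps l n =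
    (\<Sum>k<n. fps_const (of_nat (n choose k) * ((- 1) ^ (n - k - 1) * deg_rising l 1 (n - k)))
       * deg_falling_fps l k)"
proof (rule fps_ext)
  fix j
  \<comment> \<open>The exponent is one less than in \<open>deg_falling_uminus\<close>, which leaves
    a minus sign.\<close>
  have sign: "(- 1) ^ (n - k - 1) * deg_rising l 1 (n - k) = - deg_falling l (- 1) (n - k)"
    if "k < n" for k
  proof -
    from that obtain m where "n - k = Suc m"
      by (metis Suc_diff_Suc)
    then show ?thesis by (simp add: deg_falling_uminus)
  qed
  \<comment> \<open>The term \<open>k = n\<close> is split off: it is the coefficient of the series
    for \<open>n\<close> itself.\<close>
  have "deg_falling l (of_nat j) n = deg_falling l ((of_nat j + 1) + (- 1)) n"
    by simp
  also have "\<dots> = (\<Sum>k<n. of_nat (n choose k) * deg_falling l (of_nat j + 1) k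
      * deg_falling l (- 1) (n - k)) + deg_falling l (of_nat j + 1) n"
    unfolding deg_falling_Vandermonde by (simp flip: lessThan_Suc_atMost)
  finally have vandermonde: "deg_falling l (of_nat j + 1) n - deg_falling l (of_nat j) n =
      (\<Sum>k<n. of_nat (n choose k) * (- deg_falling l (- 1) (n - k)) * deg_falling l (of_nat j + 1) k)"
    by (simp add: sum_negf mult_ac)
  \<comment> \<open>For \<open>j = 0\<close> there is no shifted coefficient to subtract, which
    agrees with \<open>deg_falling l 0 n = 0\<close> because \<open>n > 0\<close>.\<close>
  have "((1 - fps_X) * deg_falling_fps l n) $ j =
      deg_falling l (of_nat j + 1) n - deg_falling l (of_nat j) n"
    using assms by (cases j) (simp_all add: deg_falling_fps_def left_diff_distrib
        deg_falling_zero_left add.commute)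
  also have "\<dots> = (\<Sum>k<n. fps_const (of_nat (n choose k) * ((- 1) ^ (n - k - 1)
      * deg_rising l 1 (n - k))) * deg_falling_fps l k) $ j"
    unfolding vandermonde fps_sum_nth
    by (intro sum.cong refl) (simp add: sign deg_falling_fps_def del: One_nat_def diff_diff_left)
  finally show "((1 - fps_X) * deg_falling_fps l n) $ j = \<dots>" .
qed

theorem theorem10:
  fixes l :: real and n :: nat
  assumes "n \<ge> 1"
  shows "deg_eulerian_poly l n =
    (\<Sum>k = 0..n - 1. of_nat (n choose k) * deg_eulerian_poly l k * [:-1, 1:] ^ (n - k - 1)
       * [:deg_rising l 1 (n - k):])"
proof -
  let ?u = "1 - fps_X :: real fps"
  let ?F = "deg_falling_fps l"
  let ?c = "\<lambda>k. of_nat (n choose k) * ((- 1) ^ (n - k - 1) * deg_rising l 1 (n - k))"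
  let ?term = "\<lambda>k. of_nat (n choose k) * deg_eulerian_poly l k * [:-1, 1:] ^ (n - k - 1)
       * [:deg_rising l 1 (n - k):]"
  have X: "fps_of_poly [:-1, 1::real:] = fps_const (- 1) * ?u"
    by (simp add: fps_of_poly_pCons algebra_simps flip: fps_const_neg)
  have "fps_of_poly (?term k) = fps_const (?c k) * ?F k * ?u ^ n" if "k < n" for k
  proof -
    \<comment> \<open>The first factor comes from the Eulerian polynomial, the second from the power
      of \<open>t - 1 = - (1 - t)\<close>, so every summand carries the same
      \<open>?u ^ n\<close>.\<close>
    have "?u ^ n = ?u ^ (k + 1) * ?u ^ (n - k - 1)"
      unfolding power_add [symmetric] using that by simp
    moreover have "fps_of_poly (?term k) = of_nat (n choose k) * (?F k * ?u ^ (k + 1))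
        * (fps_const (- 1) * ?u) ^ (n - k - 1) * fps_const (deg_rising l 1 (n - k))"
      by (simp only: fps_of_poly_mult fps_of_poly_power X of_nat_poly
          fps_of_poly_deg_eulerian fps_of_poly_const fps_of_nat)
    ultimately show ?thesis
      by (simp only: power_mult_distrib fps_const_power fps_of_nat [symmetric]
          fps_const_mult [symmetric] mult_ac)
  qed
  then have "fps_of_poly (\<Sum>k<n. ?term k) = (\<Sum>k<n. fps_const (?c k) * ?F k) * ?u ^ n"
    unfolding fps_of_poly_sum sum_distrib_right by (intro sum.cong) simp_all
  \<comment> \<open>The recurrence supplies the one further factor \<open>?u\<close>.\<close>
  also have "\<dots> = ?F n * ?u ^ (n + 1)"
    using deg_falling_fps_recurrence [of n l] assms by (simp add: mult_ac)
  also have "\<dots> = fps_of_poly (deg_eulerian_poly l n)"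
    by (simp only: fps_of_poly_deg_eulerian)
  finally have "deg_eulerian_poly l n = (\<Sum>k<n. ?term k)"
    by simp
  moreover have "{..<n} = {0..n - 1}"
    using assms by auto
  ultimately show ?thesis by simp
qed

end
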